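(* Let $A$ be a complex Banach algebra with a right identity $u$ (that is, $au=a$ for all $a\in A$) such that $uA=\{ua : a\in A\}$ is commutative and semisimple. Let $D: A\times A\to A$ be a symmetric bi-derivation and let $f:A\to A$, $f(a)=D(a,a)$, be the trace of $D$. Then the following assertions are equivalent. (a) There exists $k\in\mathbb{N}$ such that $f$ is $k$-commuting. (b) There exists $k\in\mathbb{N}$ such that $f$ is $k$-centralizing. (c) There exists $k\in\mathbb{N}$ such that $f$ is $k$-skew commuting. (d) There exists $k\in\mathbb{N}$ such that $f$ is $k$-skew centralizing. (e) $D=0$.
   Context: A mapping $D:A\times A\to A$ is called symmetric bi-linear if $D(a,b)=D(b,a)$, $D(\alpha a,b)=\alpha D(a,b)$ and $D(a+b,c)=D(a,c)+D(b,c)$ for all $a,b,c\in A$ and $\alpha\in\mathbb{C}$ (no continuity is assumed). A symmetric bi-derivation of $A$ is a symmetric bi-linear mapping $D:A\times A\to A$ such that $D(ab,c)=D(a,c)b+aD(b,c)$ for all $a,b,c\in A$. Let $Z(A)=\{a\in A : ax=xa \text{ for all } x\in A\}$. Here $\mathbb{N}=\{1,2,3,\dots\}$. For a mapping $T:A\to A$ and $k\in\mathbb{N}$, write $[T(a),a^k]=T(a)a^k-a^kT(a)$ and $\langle T(a),a^k\rangle=T(a)a^k+a^kT(a)$. The mapping $T$ is called $k$-centralizing if $[T(a),a^k]\in Z(A)$ for every $a\in A$; $k$-commuting if $[T(a),a^k]=0$ for every $a\in A$; $k$-skew centralizing if $\langle T(a),a^k\rangle\in Z(A)$ for every $a\in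 A$; and $k$-skew commuting if $\langle T(a),a^k\rangle=0$ for every $a\in A$. *)

theory Defs
  imports "HOL-Analysis.Analysis"
begin

text \<open>
  Complex Banach algebras, associative but not assumed to be unital.  The real scalar
  multiplication underlying \<^class>\<open>real_normed_algebra\<close> is the restriction of the complex one.
\<close>

class scaleC =
  fixes scaleC :: "complex \<Rightarrow> 'a \<Rightarrow> 'a"  (infixr "*\<^sub>C" 75)

class complex_banach_algebra = scaleC + real_normed_algebra + banach +
  assumes scaleC_add_right: "c *\<^sub>C (x + y) = c *\<^sub>C x + c *\<^sub>C y"
    and scaleC_add_left: "(b + c) *\<^sub>C x = b *\<^sub>C x + c *\<^sub>C x"
    and scaleC_scaleC: "b *\<^sub>C (c *\<^sub>C x) = (b * c) *\<^sub>C x"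
    and scaleC_one: "1 *\<^sub>C x = x"
    and scaleR_scaleC: "r *\<^sub>R x = complex_of_real r *\<^sub>C x"
    and mult_scaleC_left: "(c *\<^sub>C x) * y = c *\<^sub>C (x * y)"
    and mult_scaleC_right: "x * (c *\<^sub>C y) = c *\<^sub>C (x * y)"
    and norm_scaleC: "norm (c *\<^sub>C x) = norm c * norm x"

interpretation complex_vector: vector_space "scaleC :: complex \<Rightarrow> 'a \<Rightarrow> 'a::complex_banach_algebra"
  by unfold_locales
    (simp_all add: scaleC_add_right scaleC_add_left scaleC_scaleC scaleC_one)

text \<open>
  Semisimplicity in the sense of Jacobson, for a subalgebra \<open>B\<close> of the ambient algebra regarded as
  an algebra in its own right: ideals, modular units and maximality all refer to \<open>B\<close>.
  The radical is the intersection of all maximal modular left ideals, and is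
  \<open>B\<close> itself if there are none.
\<close>

definition left_ideal_of :: "'a::complex_banach_algebra set \<Rightarrow> 'a set \<Rightarrow> bool" where
  "left_ideal_of B J \<longleftrightarrow>
     J \<subseteq> B \<and> complex_vector.subspace J \<and> (\<forall>b\<in>B. \<forall>x\<in>J. b * x \<in> J)"

definition modular_left_ideal_of :: "'a::complex_banach_algebra set \<Rightarrow> 'a set \<Rightarrow> bool" where
  "modular_left_ideal_of B J \<longleftrightarrow>
     left_ideal_of B J \<and> (\<exists>e\<in>B. \<forall>b\<in>B. b - b * e \<in> J)"

definition maximal_modular_left_ideal_of ::
    "'a::complex_banach_algebra set \<Rightarrow> 'a set \<Rightarrow> bool" where
  "maximal_modular_left_ideal_of B J \<longleftrightarrow>
     modular_left_ideal_of B J \<and> J \<noteq> B \<and>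
     (\<forall>K. left_ideal_of B K \<and> J \<subseteq> K \<and> K \<noteq> B \<longrightarrow> K = J)"

definition jacobson_radical :: "'a::complex_banach_algebra set \<Rightarrow> 'a set" where
  "jacobson_radical B = B \<inter> \<Inter> {J. maximal_modular_left_ideal_of B J}"

definition semisimple :: "'a::complex_banach_algebra set \<Rightarrow> bool" where
  "semisimple B \<longleftrightarrow> jacobson_radical B = {0}"

definition commutative_on :: "'a::times set \<Rightarrow> bool" where
  "commutative_on B \<longleftrightarrow> (\<forall>x\<in>B. \<forall>y\<in>B. x * y = y * x)"

definition center :: "'a::times set" where
  "center = {a. \<forall>x. a * x = x * a}"

definition symmetric_bilinear :: "('a::complex_banach_algebra \<Rightarrow> 'a \<Rightarrow> 'a) \<Rightarrow> bool" where
  "symmetric_bilinear D \<longleftrightarrow>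
     (\<forall>a b. D a b = D b a) \<and>
     (\<forall>c a b. D (c *\<^sub>C a) b = c *\<^sub>C D a b) \<and>
     (\<forall>a b c. D (a + b) c = D a c + D b c)"

definition symmetric_biderivation :: "('a::complex_banach_algebra \<Rightarrow> 'a \<Rightarrow> 'a) \<Rightarrow> bool" where
  "symmetric_biderivation D \<longleftrightarrow>
     symmetric_bilinear D \<and> (\<forall>a b c. D (a * b) c = D a c * b + a * D b c)"

definition bitrace :: "('a \<Rightarrow> 'a \<Rightarrow> 'a) \<Rightarrow> 'a \<Rightarrow> 'a" where
  "bitrace D a = D a a"

text \<open>
  The power \<open>a\<^sup>k\<close> for \<open>k \<ge> 1\<close>; without a unit there is no \<open>a\<^sup>0\<close>, and the value
  at \<open>k = 0\<close> is junk.
\<close>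

definition pos_power :: "'a::times \<Rightarrow> nat \<Rightarrow> 'a" where
  "pos_power a k = ((\<lambda>x. a * x) ^^ (k - 1)) a"

definition k_centralizing :: "nat \<Rightarrow> ('a::ring \<Rightarrow> 'a) \<Rightarrow> bool" where
  "k_centralizing k T \<longleftrightarrow> (\<forall>a. T a * pos_power a k - pos_power a k * T a \<in> center)"

definition k_commuting :: "nat \<Rightarrow> ('a::ring \<Rightarrow> 'a) \<Rightarrow> bool" where
  "k_commuting k T \<longleftrightarrow> (\<forall>a. T a * pos_power a k - pos_power a k * T a = 0)"

definition k_skew_centralizing :: "nat \<Rightarrow> ('a::ring \<Rightarrow> 'a) \<Rightarrow> bool" where
  "k_skew_centralizing k T \<longleftrightarrow> (\<forall>a. T a * pos_power a k + pos_power a k * T a \<in> center)"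

definition k_skew_commuting :: "nat \<Rightarrow> ('a::ring \<Rightarrow> 'a) \<Rightarrow> bool" where
  "k_skew_commuting k T \<longleftrightarrow> (\<forall>a. T a * pos_power a k + pos_power a k * T a = 0)"

end

theory Submission
  imports Defs "HOL-Computational_Algebra.Formal_Power_Series"
begin

text \<open>
  Write \<open>A\<close> for the algebra and \<open>N = {n. u * n = 0}\<close>.  Since \<open>a * n = (a * u) * n\<close>, the set \<open>N\<close> is the right
  annihilator of \<open>A\<close>, and \<open>A / N\<close> is isomorphic to the commutative semisimple unital algebra
  \<open>{u * a |a. True}\<close>.  For fixed \<open>c\<close> the map \<open>\<lambda>a. D a c\<close> is a derivation, and it induces a
  derivation on that quotient.  A derivation of a commutative semisimple Banach algebra is
  zero, even without continuity (Johnson's theorem,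
  \<open>johnson_derivation_vanishes\<close>), so \<open>D\<close> takes all its values in \<open>N\<close>.

  The remaining argument is short.  Now \<open>a * f b = 0\<close> for all \<open>a\<close> and \<open>b\<close>, so the commutator and the
  anticommutator of \<open>f a\<close> with \<open>a ^ k\<close> both equal \<open>f a * a ^ k\<close>, an element of \<open>N\<close>.  As a central
  element \<open>z\<close> satisfies \<open>z = z * u = u * z\<close>, the centre meets \<open>N\<close> only in zero.  Each of the four
  conditions therefore says that \<open>f a * a ^ k = 0\<close> for all \<open>a\<close>.  Replace \<open>a\<close> by \<open>a + r u\<close> with \<open>r > norm a\<close>:
  right multiplication by this element is injective, so \<open>f (a + r u) = 0\<close>.  In particular \<open>f u = 0\<close>, so
  \<open>f (a + r u) = f a + 2 r D a u\<close>; as it vanishes for two values of \<open>r\<close>, \<open>f a = 0\<close>, and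
  polarization yields \<open>D = 0\<close>.

  Johnson's theorem is proved for a Banach algebra with a right identity in which an element is in
  \<open>N\<close> as soon as all characters kill it.  Semisimplicity provides this separation property
  (\<open>semisimple_characters_separate\<close>) through the Gelfand--Mazur theorem.  A gliding hump shows that
  \<open>\<phi> \<circ> d\<close> is unbounded for only finitely many characters \<open>\<phi>\<close> (\<open>finite_discontinuity_characters\<close>); the separation
  property implies that the other characters already separate; the closed graph theorem
  makes \<open>a \<mapsto> u * d a\<close> bounded; and bounded derivations vanish by comparing the growth of factorials with
  that of powers (\<open>singer_wermer\<close>).
\<close>

section \<open>Category arguments\<close>

text \<open>
  The Baire category theorem in the form in which it is used twice below: to prove the closed graph
  theorem and to separate countably many characters by a single element.
\<close>

lemma closed_cover_imp_interior:
  fixes S :: "nat \<Rightarrow> 'a::complete_space set"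
  assumes "\<And>n. closed (S n)" and "(\<Union>n. S n) = UNIV"
  obtains n where "interior (S n) \<noteq> {}"
proof -
  have "\<exists>n. interior (S n) \<noteq> {}"
  proof (rule ccontr)
    assume "\<not> ?thesis"
    then have "Met_TC.mtopology interior_of \<Union>(range S) = {}"
      using assms(1)
      by (intro Met_TC.metric_Baire_category_alt) (auto simp: mcomplete_iff_complete complete_UNIV)
    then show False
      using assms(2) by simp
  qed
  then show ?thesis using that by blast
qed

text \<open>
  The closed graph theorem.  By Baire some sublevel set of \<open>\<lambda>x. norm (f x)\<close> is dense in a ball, so
  every \<open>x\<close> can be approximated arbitrarily well by some \<open>b\<close> with \<open>norm (f b) \<le> K * norm x\<close>.
  Approximating again the error that is left, with errors halved each time, writes \<open>x\<close> as a
  series whose image series converges absolutely to a vector of norm at most \<open>2 * K * norm x\<close>;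
  the graph being closed, that vector is \<open>f x\<close>.
\<close>

theorem closed_graph_imp_bounded_linear:
  fixes f :: "'a::banach \<Rightarrow> 'b::banach"
  assumes lin: "linear f"
    and graph: "\<And>X y. X \<longlonglongrightarrow> 0 \<Longrightarrow> (\<lambda>n. f (X n)) \<longlonglongrightarrow> y \<Longrightarrow> y = 0"
  shows "bounded_linear f"
proof -
  define S where "S n = closure {x. norm (f x) \<le> real n}" for n
  have "(\<Union>n. S n) = UNIV"
  proof -
    have "x \<in> S (nat \<lceil>norm (f x)\<rceil>)" for x
      unfolding S_def by (rule subsetD[OF closure_subset]) (simp add: real_nat_ceiling_ge)
    then show ?thesis by blast
  qed
  moreover have "closed (S n)" for n by (simp add: S_def)
  ultimately obtain n where "interior (S n) \<noteq> {}"
    using closed_cover_imp_interior by blast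
  then obtain x0 r where r: "r > 0" and ball: "ball x0 r \<subseteq> S n"
    by (metis all_not_in_conv mem_interior)
  define K where "K = 4 * real n / r"
  have K: "K \<ge> 0" using r by (simp add: K_def)
  have approx: "\<exists>b. norm (x - b) < e \<and> norm (f b) \<le> K * norm x" if e: "e > 0" for x e
  proof (cases "x = 0")
    case True
    then show ?thesis using e by (intro exI[of _ 0]) (simp add: linear_0[OF lin])
  next
    case False
    \<comment> \<open>the factor that moves \<open>x\<close> to norm \<open>r / 2\<close>, inside the ball\<close>
    define s where "s = r / (2 * norm x)"
    have s: "s > 0" using False r by (simp add: s_def)
    define \<delta> where "\<delta> = e * s / 2"
    have \<delta>: "\<delta> > 0" using e s by (simp add: \<delta>_def)
    have "x0 + s *\<^sub>R x \<in> ball x0 r"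
      using False r by (simp add: s_def dist_norm)
    then have "x0 + s *\<^sub>R x \<in> S n" using ball by blast
    then obtain p where p: "norm (f p) \<le> n" "dist p (x0 + s *\<^sub>R x) < \<delta>"
      unfolding S_def closure_approachable using \<delta> by auto
    have "x0 \<in> S n" using ball r by auto
    then obtain p' where p': "norm (f p') \<le> n" "dist p' x0 < \<delta>"
      unfolding S_def closure_approachable using \<delta> by auto
    define b where "b = (1 / s) *\<^sub>R (p - p')"
    have "norm (s *\<^sub>R x - (p - p')) < 2 * \<delta>"
    proof -
      have "s *\<^sub>R x - (p - p') = (p' - x0) - (p - (x0 + s *\<^sub>R x))" by simp
      then have "norm (s *\<^sub>R x - (p - p')) \<le> norm (p' - x0) + norm (p - (x0 + s *\<^sub>R x))"
        by (metis norm_triangle_ineq4)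
      then show ?thesis
        using p(2) p'(2) by (simp add: dist_norm)
    qed
    moreover have "x - b = (1 / s) *\<^sub>R (s *\<^sub>R x - (p - p'))"
      using s by (simp add: b_def algebra_simps)
    ultimately have "norm (x - b) < (1 / s) * (2 * \<delta>)"
      using s by (simp add: divide_strict_right_mono)
    then have "norm (x - b) < e"
      using s by (simp add: \<delta>_def)
    moreover have "norm (f b) \<le> K * norm x"
    proof -
      have "f b = (1 / s) *\<^sub>R (f p - f p')"
        by (simp add: b_def linear_cmul[OF lin] linear_diff[OF lin])
      moreover have "norm (f p - f p') \<le> 2 * n"
        using norm_triangle_ineq4[of "f p" "f p'"] p(1) p'(1) by simp
      ultimately have "norm (f b) \<le> (1 / s) * (2 * n)"
        using s by (simp add: divide_right_mono)
      also have "\<dots> = K * norm x"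
        using s r False by (simp add: s_def K_def field_simps)
      finally show ?thesis .
    qed
    ultimately show ?thesis by blast
  qed
  have bound: "norm (f x) \<le> norm x * (2 * K)" for x
  proof (cases "x = 0")
    case True
    then show ?thesis by (simp add: linear_0[OF lin])
  next
    case False
    \<comment> \<open>\<open>X n\<close> is the error left after \<open>n\<close> approximations\<close>
    have "\<exists>X. \<forall>n. (norm (X n) \<le> norm x * (1/2)^n \<and> (n = 0 \<longrightarrow> X n = x))
              \<and> norm (f (X n - X (Suc n))) \<le> K * norm x * (1/2)^n"
    proof (rule dependent_nat_choice)
      fix z n
      assume z: "norm z \<le> norm x * (1/2)^n \<and> (n = 0 \<longrightarrow> z = x)"
      obtain b where b: "norm (z - b) < norm x * (1/2)^Suc n" "norm (f b) \<le> K * norm z"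
        using approx[of "norm x * (1/2)^Suc n" z] False by auto
      have "K * norm z \<le> K * (norm x * (1/2)^n)"
        using z K by (intro mult_left_mono) auto
      then show "\<exists>y. (norm y \<le> norm x * (1/2)^Suc n \<and> (Suc n = 0 \<longrightarrow> y = x))
              \<and> norm (f (z - y)) \<le> K * norm x * (1/2)^n"
        using b by (intro exI[of _ "z - b"]) auto
    qed auto
    then obtain X where X: "\<And>n. norm (X n) \<le> norm x * (1/2)^n" "X 0 = x"
      "\<And>n. norm (f (X n - X (Suc n))) \<le> K * norm x * (1/2)^n"
      by auto
    let ?g = "\<lambda>n. f (X n - X (Suc n))"
    have geo: "summable (\<lambda>n. K * norm x * (1/2::real)^n)"
      by (intro summable_mult summable_geometric) auto
    have sg: "summable (\<lambda>n. norm (?g n))"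
      by (rule summable_comparison_test'[OF geo, of 0]) (use X(3) in simp)
    have X0: "X \<longlonglongrightarrow> 0"
    proof (rule Lim_null_comparison)
      show "\<forall>\<^sub>F n in sequentially. norm (X n) \<le> norm x * (1/2)^n" using X(1) by simp
      show "(\<lambda>n. norm x * (1/2)^n) \<longlonglongrightarrow> 0"
        by (intro tendsto_mult_right_zero LIMSEQ_power_zero) auto
    qed
    have tele: "(\<Sum>k<n. ?g k) = f x - f (X n)" for n
      by (induction n) (simp_all add: X(2) linear_diff[OF lin] linear_0[OF lin])
    have "(\<lambda>n. f x - f (X n)) \<longlonglongrightarrow> suminf ?g"
      using summable_LIMSEQ[OF summable_norm_cancel[OF sg]] by (simp add: tele)
    then have "(\<lambda>n. f x - (f x - f (X n))) \<longlonglongrightarrow> f x - suminf ?g"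
      by (intro tendsto_diff tendsto_const)
    then have "f x - suminf ?g = 0"
      by (intro graph[OF X0]) simp
    then have "norm (f x) = norm (suminf ?g)" by simp
    also have "\<dots> \<le> (\<Sum>n. norm (?g n))" by (rule summable_norm[OF sg])
    also have "\<dots> \<le> (\<Sum>n. K * norm x * (1/2::real)^n)"
      by (rule suminf_le[OF X(3) sg geo])
    also have "\<dots> = norm x * (2 * K)"
      by (subst suminf_mult) (auto simp: suminf_geometric)
    finally show ?thesis .
  qed
  show ?thesis
    by (rule bounded_linear_intro[OF _ _ bound]) (simp_all add: linear_add[OF lin] linear_cmul[OF lin])
qed

section \<open>Characters\<close>

text \<open>
  \<open>s = v + t * v + t * t * v + \<dots>\<close>, obtained as a fixed point because there need not be a unit.
\<close>

lemma neumann_solution: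
  fixes t v :: "'a::{real_normed_algebra,banach}"
  assumes "norm t < 1"
  obtains s where "s = v + t * s"
proof -
  have "\<exists>!s. v + t * s = s"
  proof (rule banach_fix_type[of "norm t"])
    show "\<forall>x y. dist (v + t * x) (v + t * y) \<le> norm t * dist x y"
      by (metis add_diff_cancel_left dist_norm norm_mult_ineq right_diff_distrib)
  qed (use assms in auto)
  then show ?thesis using that by metis
qed

definition character :: "('a::complex_banach_algebra \<Rightarrow> complex) \<Rightarrow> bool" where
  "character \<phi> \<longleftrightarrow> (\<forall>a b. \<phi> (a + b) = \<phi> a + \<phi> b) \<and> (\<forall>c a. \<phi> (c *\<^sub>C a) = c * \<phi> a) \<and>
     (\<forall>a b. \<phi> (a * b) = \<phi> a * \<phi> b) \<and> (\<exists>a. \<phi> a \<noteq> 0)"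

context
  fixes \<phi> :: "'a::complex_banach_algebra \<Rightarrow> complex"
  assumes \<phi>: "character \<phi>"
begin

lemma character_add: "\<phi> (a + b) = \<phi> a + \<phi> b"
  and character_scaleC: "\<phi> (c *\<^sub>C a) = c * \<phi> a"
  and character_mult: "\<phi> (a * b) = \<phi> a * \<phi> b"
  and character_nonzero: "\<exists>a. \<phi> a \<noteq> 0"
  using \<phi> by (simp_all add: character_def)

lemma character_zero: "\<phi> 0 = 0"
  using character_add[of 0 0] by simp

lemma character_diff: "\<phi> (a - b) = \<phi> a - \<phi> b"
  using character_add[of "a - b" b] by simp

lemma character_scaleR: "\<phi> (r *\<^sub>R a) = r *\<^sub>R \<phi> a"
  by (simp add: scaleR_scaleC character_scaleC scaleR_conv_of_real)

lemma character_right_identity: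
  assumes "\<And>a. a * u = a"
  shows "\<phi> u = 1"
  by (metis assms character_mult character_nonzero mult_cancel_left1 mult.commute)

text \<open>
  If the bound failed, scaling would give \<open>t\<close> with \<open>norm t < 1\<close> and \<open>\<phi> t = 1\<close>, and applying \<open>\<phi>\<close> to a
  solution of \<open>s = t + t * s\<close> would give \<open>\<phi> s = 1 + \<phi> s\<close>.
\<close>

lemma character_norm_le: "norm (\<phi> a) \<le> norm a"
proof (rule ccontr)
  assume "\<not> ?thesis"
  then have lt: "norm a < norm (\<phi> a)" and nz: "\<phi> a \<noteq> 0" by auto
  define t where "t = inverse (\<phi> a) *\<^sub>C a"
  have "norm t < 1"
    using lt nz by (simp add: t_def norm_scaleC norm_inverse inverse_eq_divide norm_divide)
  then obtain s where "s = t + t * s" by (rule neumann_solution)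
  then have "\<phi> s = \<phi> t + \<phi> t * \<phi> s" by (metis character_add character_mult)
  moreover have "\<phi> t = 1" using nz by (simp add: t_def character_scaleC)
  ultimately show False by simp
qed

lemma character_bounded_linear: "bounded_linear \<phi>"
  by (rule bounded_linear_intro[of _ 1]) (simp_all add: character_add character_scaleR character_norm_le)

end

section \<open>The Gelfand--Mazur theorem\<close>

lemma sum_powers_of_root_of_unity:
  fixes n j :: nat
  assumes "0 < j" "j < n"
  shows "(\<Sum>k<n. (cis (2 * pi / n) ^ k) ^ j) = 0"
proof -
  define w where "w = cis (2 * pi / n) ^ j"
  have "cis (2 * pi / n) ^ n = 1" using assms by (simp add: Complex.DeMoivre)
  then have n: "w ^ n = 1"
    by (metis w_def mult.commute power_mult power_one)
  have "w = cis (real j * (2 * pi / n))"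
    by (simp only: w_def Complex.DeMoivre)
  then have "w = exp (2 * of_real pi * \<i> * of_nat j / of_nat n)"
    by (simp add: cis_conv_exp algebra_simps)
  then have "w \<noteq> 1"
    using complex_root_unity_eq[of n j 0] assms by auto
  have "(\<Sum>k<n. (cis (2 * pi / n) ^ k) ^ j) = (\<Sum>k<n. w ^ k)"
    by (simp add: w_def power_mult[symmetric] mult.commute)
  also have "\<dots> = 0"
    using n \<open>w \<noteq> 1\<close> by (simp add: sum_gp_strict)
  finally show ?thesis .
qed

text \<open>
  The Gelfand--Mazur theorem for the quotient by an ideal \<open>J\<close>, phrased with congruences modulo \<open>J\<close>
  and an algebra seminorm \<open>q\<close> in the role of the quotient norm.

  Suppose \<open>x - c *\<^sub>C u\<close> is invertible modulo \<open>J\<close> for every \<open>c\<close>, with inverse \<open>R c\<close>.  Then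
  \<open>h c = 1 / q (R c)\<close> is Lipschitz by the resolvent identity and tends to infinity, so it attains a
  minimum \<open>m\<close>.  Instead of Liouville's theorem a discrete mean value property shows that \<open>h\<close> stays
  at \<open>m\<close> near a minimum point \<open>c\<close>: averaging the geometric expansion of \<open>R (c + s)\<close> over
  the rotations of \<open>s\<close> by \<open>n\<close>-th roots of unity leaves \<open>R c\<close> up to an error that is
  exponentially small in \<open>n\<close>.  As none of the \<open>n\<close> terms exceeds the maximum \<open>M = 1 / m\<close> of \<open>q (R c)\<close>
  and their average almost reaches it, each term, in particular \<open>R (c + s)\<close> itself, falls
  short of \<open>M\<close> by at most \<open>n\<close> times that error, which still tends to zero.  So the set of minimum points is
  open and closed, \<open>h\<close> is constant, and this contradicts its growth.
\<close>

theorem gelfand_mazur_modulo_ideal: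
  fixes J :: "'a::complex_banach_algebra set" and u x :: 'a and q :: "'a \<Rightarrow> real"
  assumes J: "complex_vector.subspace J"
    and ideal: "\<And>a b. a \<in> J \<Longrightarrow> a * b \<in> J" "\<And>a b. b \<in> J \<Longrightarrow> a * b \<in> J"
    and comm: "\<And>a b. a * b - b * a \<in> J"
    and right_identity: "\<And>a. a * u = a"
    and inv: "\<And>a. a \<notin> J \<Longrightarrow> \<exists>b. b * a - u \<in> J"
    and q_add: "\<And>a b. q (a + b) \<le> q a + q b"
    and q_scaleC: "\<And>c a. q (c *\<^sub>C a) = cmod c * q a"
    and q_mult: "\<And>a b. q (a * b) \<le> q a * q b"
    and q_J: "\<And>a. a \<in> J \<Longrightarrow> q a = 0"
    and q_u: "q u > 0"
  shows "\<exists>c. x - c *\<^sub>C u \<in> J"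
proof (rule ccontr)
  note J_add = complex_vector.subspace_add[OF J]
  note J_diff = complex_vector.subspace_diff[OF J]
  note J_scale = complex_vector.subspace_scale[OF J]
  note J_sum = complex_vector.subspace_sum[OF J]
  have q_minus: "q (- a) = q a" for a
    using q_scaleC[of "-1" a] by simp
  have q_nonneg: "q a \<ge> 0" for a
    using q_add[of a "- a"] q_minus[of a] q_J[OF complex_vector.subspace_0[OF J]] by simp
  have q_sum: "q (sum g I) \<le> (\<Sum>i\<in>I. q (g i))" for g :: "nat \<Rightarrow> 'a" and I
  proof (induction I rule: infinite_finite_induct)
    case (insert i I)
    then show ?case using q_add[of "g i" "sum g I"] by simp
  qed (use q_J[OF complex_vector.subspace_0[OF J]] in simp_all)
  have q_cong: "q a = q b" if "a - b \<in> J" for a b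
    using q_add[of "a - b" b] q_add[of "- (a - b)" a] q_minus[of "a - b"] q_J[OF that] by simp
  have unit: "u * a - a \<in> J" for a
    using comm[of u a] right_identity by simp
  assume "\<not> ?thesis"
  then have "\<forall>c. \<exists>b. b * (x - c *\<^sub>C u) - u \<in> J" using inv by blast
  then obtain R where R: "\<And>c. R c * (x - c *\<^sub>C u) - u \<in> J" by metis
  have resolvent: "R (c + s) - R c - s *\<^sub>C (R (c + s) * R c) \<in> J" for c s
  proof -
    let ?z = "R (c + s)" and ?X = "x - c *\<^sub>C u"
    have "?X * R c - u \<in> J"
      using J_add[OF comm[of ?X "R c"] R[of c]] by simp
    then have 1: "?z * (?X * R c - u) \<in> J" by (rule ideal)
    have X: "?X - s *\<^sub>C u = x - (c + s) *\<^sub>C u" by (simp add: scaleC_add_left)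
    have "(?z * (?X - s *\<^sub>C u) - u) * R c \<in> J"
      unfolding X by (rule ideal(1)[OF R])
    moreover have "?z * (u * b) = ?z * b" for b by (metis mult.assoc right_identity)
    ultimately have 2: "?z * (?X * R c) - s *\<^sub>C (?z * R c) - u * R c \<in> J"
      by (simp only: right_diff_distrib left_diff_distrib mult_scaleC_left mult_scaleC_right
          right_identity mult.assoc)
    have eq: "?z - R c - s *\<^sub>C (?z * R c) = (?z * (?X * R c) - s *\<^sub>C (?z * R c) - u * R c)
        - ?z * (?X * R c - u) + (u * R c - R c)"
      by (simp only: right_diff_distrib right_identity) (simp add: algebra_simps)
    show ?thesis unfolding eq by (rule J_add[OF J_diff[OF 2 1] unit])
  qed
  have qR: "q (R c) > 0" for c
  proof -
    have "q u = q (R c * (x - c *\<^sub>C u))" using q_cong[OF R[of c]] by simp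
    also have "\<dots> \<le> q (R c) * q (x - c *\<^sub>C u)" by (rule q_mult)
    finally show ?thesis using q_u q_nonneg[of "R c"] by (cases "q (R c) = 0") auto
  qed
  \<comment> \<open>taking reciprocals turns the resolvent identity into a Lipschitz bound with constant 1\<close>
  define h where "h c = inverse (q (R c))" for c
  have h_pos: "h c > 0" for c using qR by (simp add: h_def)
  have q_h: "q (R c) = inverse (h c)" for c by (simp add: h_def)
  have h_lip: "h (c + s) \<le> h c + cmod s" for c s
  proof -
    have "q (R c) \<le> q (R (c + s)) + cmod s * (q (R (c + s)) * q (R c))"
    proof -
      have eq: "R c - (R (c + s) + (- s) *\<^sub>C (R (c + s) * R c)) =
          - (R (c + s) - R c - s *\<^sub>C (R (c + s) * R c))"
        by (simp add: complex_vector.scale_minus_left)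
      have "q (R c) = q (R (c + s) + (- s) *\<^sub>C (R (c + s) * R c))"
        by (rule q_cong) (unfold eq, rule complex_vector.subspace_neg[OF J resolvent])
      also have "\<dots> \<le> q (R (c + s)) + cmod s * q (R (c + s) * R c)"
        using q_add[of "R (c + s)" "(- s) *\<^sub>C (R (c + s) * R c)"] q_scaleC[of "- s"] by simp
      also have "\<dots> \<le> q (R (c + s)) + cmod s * (q (R (c + s)) * q (R c))"
        by (intro add_left_mono mult_left_mono q_mult) simp
      finally show ?thesis .
    qed
    then have "q (R c) * (inverse (q (R c)) * inverse (q (R (c + s)))) \<le>
       (q (R (c + s)) + cmod s * (q (R (c + s)) * q (R c))) * (inverse (q (R c)) * inverse (q (R (c + s))))"
      using qR by (intro mult_right_mono) (simp_all add: less_imp_le)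
    then show ?thesis
      using qR[of c] qR[of "c + s"] by (simp add: h_def field_simps)
  qed
  have h_cont: "continuous_on UNIV h"
  proof -
    have "dist (h a) (h b) \<le> 1 * dist a b" for a b
      using h_lip[of a "b - a"] h_lip[of b "a - b"]
      by (simp add: dist_norm norm_minus_commute abs_le_iff)
    then have "1-lipschitz_on UNIV h" by (intro lipschitz_onI) auto
    then show ?thesis by (rule lipschitz_on_continuous_on)
  qed
  have growth: "cmod c - q x \<le> q u * h c" for c
  proof -
    have eq: "c *\<^sub>C R c - (R c * x + (- 1) *\<^sub>C u) = - (R c * (x - c *\<^sub>C u) - u)"
      by (simp add: right_diff_distrib mult_scaleC_right right_identity complex_vector.scale_minus_left)
    have "q (c *\<^sub>C R c) = q (R c * x + (- 1) *\<^sub>C u)"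
      by (rule q_cong) (unfold eq, rule complex_vector.subspace_neg[OF J R])
    also have "\<dots> \<le> q (R c * x) + q ((- 1) *\<^sub>C u)" by (rule q_add)
    also have "\<dots> \<le> q (R c) * q x + q u"
      using q_mult[of "R c" x] q_scaleC[of "-1" u] by simp
    finally have "(cmod c - q x) * q (R c) \<le> q u"
      by (simp add: q_scaleC algebra_simps)
    then show ?thesis using qR[of c] by (simp add: h_def field_simps)
  qed
  have large: "h c > K" if "cmod c > q x + q u * K" for c K
    using growth[of c] that q_u by (smt (verit) mult_le_cancel_left_pos)
  obtain c0 where min: "\<And>c. h c0 \<le> h c"
  proof -
    define K where "K = q x + q u * h 0"
    have K: "K \<ge> 0" using q_nonneg h_pos[of 0] by (simp add: K_def)
    obtain c0 where c0: "c0 \<in> cball 0 K" "\<And>c. c \<in> cball 0 K \<Longrightarrow> h c0 \<le> h c"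
      using continuous_attains_inf[of "cball 0 K" h] h_cont K continuous_on_subset
      by (metis cball_eq_empty compact_cball not_less top_greatest)
    have "h c0 \<le> h 0" using c0(2)[of 0] K by simp
    then have "h c0 \<le> h c" for c
      using c0(2)[of c] large[of "h 0" c] by (cases "cmod c \<le> K") (auto simp: K_def)
    then show ?thesis by (rule that)
  qed
  define m where "m = h c0"
  have m: "m > 0" "\<And>c. m \<le> h c" using h_pos min by (auto simp: m_def)
  define M where "M = inverse m"
  have M: "M > 0" "\<And>c. q (R c) \<le> M" using m qR h_pos by (auto simp: M_def q_h le_imp_inverse_le)
  have propagate: "h (c + s) = m" if hc: "h c = m" and s: "cmod s < m" for c s
  proof -
    have qc: "q (R c) = M" using hc by (simp add: q_h M_def)
    \<comment> \<open>powers of \<open>R c\<close> are right multiplications iterated, which avoids a zeroth power\<close>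
    define T where "T a = a * R c" for a
    have T_J: "a - b \<in> J \<Longrightarrow> (T ^^ n) a - (T ^^ n) b \<in> J" for a b n
      by (induction n) (auto simp: T_def left_diff_distrib[symmetric] intro: ideal)
    have q_T: "q ((T ^^ n) a) \<le> q a * M ^ n" for a n
    proof (induction n)
      case (Suc n)
      have "q ((T ^^ Suc n) a) \<le> q ((T ^^ n) a) * M"
        using q_mult[of "(T ^^ n) a" "R c"] by (simp add: T_def qc)
      also have "\<dots> \<le> (q a * M ^ n) * M" using Suc M by (intro mult_right_mono) auto
      finally show ?case by (simp add: mult_ac)
    qed simp
    have T_add: "(T ^^ n) (a + b) = (T ^^ n) a + (T ^^ n) b" for n a b
      by (induction n) (simp_all add: T_def distrib_right)
    have T_scaleC: "(T ^^ n) (s *\<^sub>C a) = s *\<^sub>C (T ^^ n) a" for n s a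
      by (induction n) (simp_all add: T_def mult_scaleC_left)
    have T_0: "(T ^^ n) 0 = 0" for n by (induction n) (simp_all add: T_def)
    have T_sum: "(T ^^ n) (sum g I) = (\<Sum>i\<in>I. (T ^^ n) (g i))" for n I and g :: "nat \<Rightarrow> 'a"
      by (induction I rule: infinite_finite_induct) (simp_all add: T_add T_0)
    have expand: "R (c + s) - ((\<Sum>j<n. s ^ j *\<^sub>C (T ^^ j) (R c)) + s ^ n *\<^sub>C (T ^^ n) (R (c + s))) \<in> J" for s n
    proof (induction n)
      case 0
      show ?case using complex_vector.subspace_0[OF J] by (simp add: scaleC_one)
    next
      case (Suc n)
      have "R (c + s) - (R c + s *\<^sub>C T (R (c + s))) \<in> J"
        using resolvent[of c s] by (simp add: T_def diff_diff_eq)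
      from J_scale[OF T_J[OF this, of n], of "s ^ n"]
      have "s ^ n *\<^sub>C (T ^^ n) (R (c + s)) - (s ^ n *\<^sub>C (T ^^ n) (R c) + s ^ Suc n *\<^sub>C (T ^^ Suc n) (R (c + s))) \<in> J"
        by (simp add: T_add T_scaleC complex_vector.scale_right_diff_distrib scaleC_add_right scaleC_scaleC
            funpow_swap1 mult.commute)
      from J_add[OF Suc this] show ?case by (simp add: algebra_simps)
    qed
    have lower: "M - real n * M * (cmod s * M) ^ n \<le> q (R (c + s))" if n: "n > 0" for n
    proof -
      define w where "w = cis (2 * pi / n)"
      define z where "z k = R (c + s * w ^ k)" for k
      have wn: "w ^ n = 1" using n by (simp add: w_def Complex.DeMoivre)
      have wkn: "(s * w ^ k) ^ n = s ^ n" for k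
        by (metis wn mult.commute power_mult power_one power_mult_distrib mult_1)
      have swap: "(\<Sum>k<n. \<Sum>j<n. (s * w ^ k) ^ j *\<^sub>C (T ^^ j) (R c))
          = (\<Sum>j<n. (\<Sum>k<n. (s * w ^ k) ^ j) *\<^sub>C (T ^^ j) (R c))"
        by (subst sum.swap) (simp add: complex_vector.scale_sum_left)
      have sum0: "(\<Sum>k<n. (s * w ^ k) ^ j) = (if j = 0 then of_nat n else 0)" if "j < n" for j
        using sum_powers_of_root_of_unity[of j n] that
        by (auto simp: w_def power_mult_distrib sum_distrib_left[symmetric])
      have "(\<Sum>k<n. z k - ((\<Sum>j<n. (s * w ^ k) ^ j *\<^sub>C (T ^^ j) (R c)) + (s * w ^ k) ^ n *\<^sub>C (T ^^ n) (z k))) \<in> J"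
        unfolding z_def by (intro J_sum expand)
      also have "(\<Sum>k<n. z k - ((\<Sum>j<n. (s * w ^ k) ^ j *\<^sub>C (T ^^ j) (R c)) + (s * w ^ k) ^ n *\<^sub>C (T ^^ n) (z k)))
        = (\<Sum>k<n. z k) - ((\<Sum>j<n. (\<Sum>k<n. (s * w ^ k) ^ j) *\<^sub>C (T ^^ j) (R c)) + s ^ n *\<^sub>C (T ^^ n) (\<Sum>k<n. z k))"
        by (simp only: sum_subtractf sum.distrib wkn T_sum swap complex_vector.scale_sum_right)
      also have "(\<Sum>j<n. (\<Sum>k<n. (s * w ^ k) ^ j) *\<^sub>C (T ^^ j) (R c)) = of_nat n *\<^sub>C R c"
      proof -
        have "(\<Sum>j<n. (\<Sum>k<n. (s * w ^ k) ^ j) *\<^sub>C (T ^^ j) (R c))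
            = (\<Sum>j<n. if j = 0 then of_nat n *\<^sub>C R c else 0)"
          by (intro sum.cong) (auto simp: sum0 simp del: of_nat_sum)
        also have "\<dots> = of_nat n *\<^sub>C R c" using n by simp
        finally show ?thesis .
      qed
      finally have "q (\<Sum>k<n. z k) = q (of_nat n *\<^sub>C R c + s ^ n *\<^sub>C (T ^^ n) (\<Sum>k<n. z k))"
        by (rule q_cong)
      moreover have "q (of_nat n *\<^sub>C R c) \<le> q (of_nat n *\<^sub>C R c + s ^ n *\<^sub>C (T ^^ n) (\<Sum>k<n. z k))
            + q (s ^ n *\<^sub>C (T ^^ n) (\<Sum>k<n. z k))"
        using q_add[of "of_nat n *\<^sub>C R c + s ^ n *\<^sub>C (T ^^ n) (\<Sum>k<n. z k)" "- (s ^ n *\<^sub>C (T ^^ n) (\<Sum>k<n. z k))"]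
        by (simp add: q_minus)
      ultimately have "real n * M \<le> q (\<Sum>k<n. z k) + cmod s ^ n * q ((T ^^ n) (\<Sum>k<n. z k))"
        by (simp add: q_scaleC qc norm_power)
      also have "\<dots> \<le> q (\<Sum>k<n. z k) + cmod s ^ n * ((real n * M) * M ^ n)"
      proof -
        have "q (\<Sum>k<n. z k) \<le> real n * M"
          using q_sum[of z "{..<n}"] sum_bounded_above[of "{..<n}" "\<lambda>k. q (z k)" M] M(2) by (simp add: z_def)
        then have "q (\<Sum>k<n. z k) * M ^ n \<le> (real n * M) * M ^ n"
          using M by (intro mult_right_mono) auto
        then show ?thesis
          using q_T[of n "\<Sum>k<n. z k"] by (intro add_left_mono mult_left_mono) auto
      qed
      \<comment> \<open>the rotation by \<open>w ^ 0 = 1\<close> is the term that is kept; the other \<open>n - 1\<close> are bounded by \<open>M\<close>\<close>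
      also have "q (\<Sum>k<n. z k) \<le> q (z 0) + (real n - 1) * M"
      proof -
        have "q (\<Sum>k<n. z k) \<le> (\<Sum>k<n. q (z k))" by (rule q_sum)
        also have "\<dots> = q (z 0) + (\<Sum>k\<in>{..<n} - {0}. q (z k))"
          using n by (intro sum.remove) auto
        also have "(\<Sum>k\<in>{..<n} - {0}. q (z k)) \<le> real (card ({..<n} - {0})) * M"
          using M(2) by (intro sum_bounded_above) (simp add: z_def)
        also have "real (card ({..<n} - {0})) = real n - 1"
          using n by (simp add: of_nat_diff)
        finally show ?thesis by simp
      qed
      finally show ?thesis
        by (simp add: z_def algebra_simps power_mult_distrib)
    qed
    have "(\<lambda>n. M - M * (real n * (cmod s * M) ^ n)) \<longlonglongrightarrow> M - M * 0"
    proof (intro tendsto_intros)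
      have "cmod s * M < 1" using s m by (simp add: M_def field_simps)
      then show "(\<lambda>n. real n * (cmod s * M) ^ n) \<longlonglongrightarrow> 0"
        using M by (intro powser_times_n_limit_0) simp
    qed
    then have "M \<le> q (R (c + s))"
      using lower by (intro LIMSEQ_le_const2[of _ M "q (R (c + s))"]) (auto intro!: exI[of _ 1] simp: mult_ac)
    then have "h (c + s) \<le> m" using M by (simp add: h_def M_def) (metis inverse_inverse_eq le_imp_inverse_le positive_imp_inverse_positive m(1))
    then show ?thesis using m by (simp add: order_antisym)
  qed
  have "open {c. h c = m}"
    unfolding open_dist
  proof (intro ballI exI[of _ m] conjI allI impI)
    fix c c' assume "c \<in> {c. h c = m}" "dist c' c < m"
    then show "c' \<in> {c. h c = m}" using propagate[of c "c' - c"] by (simp add: dist_norm)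
  qed (rule m)
  moreover have "closed {c. h c = m}"
    by (rule closed_Collect_eq[OF h_cont continuous_on_const])
  ultimately have "{c. h c = m} = UNIV"
    using clopen[of "{c. h c = m}"] m_def by auto
  then have "h c = m" for c by blast
  then show False
    using large[of m "of_real (q x + q u * m + 1)"] q_nonneg[of x] q_u m(1)
    by (smt (verit) norm_of_real mult_nonneg_nonneg)
qed

section \<open>Separation by characters\<close>

context
  fixes S :: "'a::complex_banach_algebra set"
  assumes S: "complex_vector.subspace S"
begin

text \<open>
  The distance to a subspace is a seminorm, and to a two-sided ideal a submultiplicative one:
  these are the quotient norms.
\<close>

lemma approx_infdist_subspace:
  assumes "e > 0"
  obtains j where "j \<in> S" "norm (a - j) < infdist a S + e"
proof -
  have ne: "S \<noteq> {}" using complex_vector.subspace_0[OF S] by auto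
  have "(INF j\<in>S. dist a j) < infdist a S + e"
    using assms by (simp add: infdist_notempty[OF ne])
  then have "\<exists>j\<in>S. dist a j < infdist a S + e"
    using ne by (subst (asm) cINF_less_iff) (auto intro: bdd_belowI2[of _ 0])
  then show ?thesis using that by (auto simp: dist_norm)
qed

lemma infdist_subspace_le: "j \<in> S \<Longrightarrow> infdist a S \<le> norm (a - j)"
  using infdist_le[of j S a] by (simp add: dist_norm)

lemma infdist_subspace_add: "infdist (a + b) S \<le> infdist a S + infdist b S"
proof (rule field_le_epsilon)
  fix e :: real assume "e > 0"
  then have e: "e / 2 > 0" by simp
  obtain j where j: "j \<in> S" "norm (a - j) < infdist a S + e / 2"
    using approx_infdist_subspace[OF e] .
  obtain k where k: "k \<in> S" "norm (b - k) < infdist b S + e / 2"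
    using approx_infdist_subspace[OF e] .
  have "infdist (a + b) S \<le> norm ((a + b) - (j + k))"
    by (intro infdist_subspace_le complex_vector.subspace_add[OF S] j k)
  also have "\<dots> \<le> norm (a - j) + norm (b - k)"
    using norm_triangle_ineq[of "a - j" "b - k"] by (simp add: algebra_simps)
  finally show "infdist (a + b) S \<le> infdist a S + infdist b S + e" using j k by simp
qed

lemma infdist_subspace_scaleC: "infdist (c *\<^sub>C a) S = cmod c * infdist a S"
proof -
  have le: "infdist (c *\<^sub>C a) S \<le> cmod c * infdist a S" if "c \<noteq> 0" for c a
  proof (rule field_le_epsilon)
    fix e :: real assume "e > 0"
    then have e: "e / cmod c > 0" using that by simp
    obtain j where j: "j \<in> S" "norm (a - j) < infdist a S + e / cmod c"
      using approx_infdist_subspace[OF e] .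
    have "infdist (c *\<^sub>C a) S \<le> norm (c *\<^sub>C a - c *\<^sub>C j)"
      by (intro infdist_subspace_le complex_vector.subspace_scale[OF S] j)
    also have "\<dots> = cmod c * norm (a - j)"
      by (simp add: norm_scaleC flip: complex_vector.scale_right_diff_distrib)
    also have "\<dots> \<le> cmod c * (infdist a S + e / cmod c)"
      using j by (intro mult_left_mono) auto
    finally show "infdist (c *\<^sub>C a) S \<le> cmod c * infdist a S + e"
      using that by (simp add: algebra_simps)
  qed
  show ?thesis
  proof (cases "c = 0")
    case True
    then show ?thesis using complex_vector.subspace_0[OF S] by simp
  next
    case False
    have "infdist (inverse c *\<^sub>C (c *\<^sub>C a)) S \<le> cmod (inverse c) * infdist (c *\<^sub>C a) S"
      using False by (intro le) simp
    then have "infdist a S \<le> infdist (c *\<^sub>C a) S / cmod c"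
      using False by (simp add: scaleC_scaleC scaleC_one norm_inverse divide_inverse mult.commute)
    then have "cmod c * infdist a S \<le> infdist (c *\<^sub>C a) S"
      using False by (simp add: field_simps)
    then show ?thesis using le[OF False] by (simp add: order_antisym)
  qed
qed

lemma infdist_ideal_mult:
  assumes ideal: "\<And>a b. a \<in> S \<Longrightarrow> a * b \<in> S" "\<And>a b. b \<in> S \<Longrightarrow> a * b \<in> S"
  shows "infdist (a * b) S \<le> infdist a S * infdist b S"
proof -
  have bound: "infdist (a * b) S \<le> (infdist a S + e) * (infdist b S + e)" if e: "e > 0" for e
  proof -
    obtain j where j: "j \<in> S" "norm (a - j) < infdist a S + e"
      using approx_infdist_subspace[OF e] .
    obtain k where k: "k \<in> S" "norm (b - k) < infdist b S + e"
      using approx_infdist_subspace[OF e] .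
    have "infdist (a * b) S \<le> norm (a * b - (j * b + (a - j) * k))"
      using j k ideal by (intro infdist_subspace_le complex_vector.subspace_add[OF S]) auto
    also have "a * b - (j * b + (a - j) * k) = (a - j) * (b - k)"
      by (simp add: algebra_simps)
    also have "norm \<dots> \<le> norm (a - j) * norm (b - k)" by (rule norm_mult_ineq)
    also have "\<dots> \<le> (infdist a S + e) * (infdist b S + e)"
      using j k infdist_nonneg[of a S] e by (intro mult_mono) auto
    finally show ?thesis .
  qed
  have "((\<lambda>e. (infdist a S + e) * (infdist b S + e)) \<longlongrightarrow> (infdist a S + 0) * (infdist b S + 0)) (at_right 0)"
    by (intro tendsto_intros)
  then have "((\<lambda>e. (infdist a S + e) * (infdist b S + e)) \<longlongrightarrow> infdist a S * infdist b S) (at_right 0)"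
    by simp
  then show ?thesis
    by (rule tendsto_lowerbound) (auto simp: eventually_at_right_less intro: eventually_mono[OF eventually_at_right_less] bound)
qed

end

text \<open>
  Gelfand theory for \<open>B = {u * a |a. True}\<close>, carried out in the whole algebra.  A maximal modular
  left ideal \<open>J\<close> of \<open>B\<close> pulls back along \<open>b \<mapsto> u * b\<close> to a two-sided ideal \<open>I\<close> with \<open>A / I\<close> isomorphic
  to the field \<open>B / J\<close>.  The unit \<open>u\<close> has positive distance from \<open>I\<close>, since elements close to
  \<open>u\<close> are invertible modulo \<open>I\<close>.  By Gelfand--Mazur every element is congruent to a multiple
  \<open>\<phi> x *\<^sub>C u\<close>, and \<open>\<phi>\<close> is a character of \<open>A\<close> that vanishes exactly on \<open>I\<close>.  So an element killed by
  all characters has its image in every \<open>J\<close>, that is, in the radical.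
\<close>

theorem semisimple_characters_separate:
  fixes u a :: "'a::complex_banach_algebra"
  assumes right_identity: "\<And>a. a * u = a"
    and comm: "commutative_on {u * a |a. True}"
    and semisimple: "semisimple {u * a |a. True}"
    and null: "\<And>\<phi>. character \<phi> \<Longrightarrow> \<phi> a = 0"
  shows "u * a = 0"
proof -
  define B where "B = {u * a |a. True}"
  have B_I: "u * b \<in> B" for b by (auto simp: B_def)
  have uB: "u \<in> B" using B_I[of u] by (simp add: right_identity)
  have mult_u: "x * (u * b) = x * b" for x b
    by (metis mult.assoc right_identity)
  have u_B: "u * b = b" if "b \<in> B" for b
    using that by (auto simp: B_def mult_u)
  have comm': "u * x * y = u * y * x" for x y
    using comm B_I[of x] B_I[of y] unfolding commutative_on_def B_def[symmetric]
    by (metis mult.assoc mult_u)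
  have "u * a \<in> J" if max: "maximal_modular_left_ideal_of B J" for J
  proof -
    have J_B: "J \<subseteq> B" and J_sub: "complex_vector.subspace J" and J_left: "\<And>b x. b \<in> B \<Longrightarrow> x \<in> J \<Longrightarrow> b * x \<in> J"
      and J_ne: "J \<noteq> B" and J_max: "\<And>K. left_ideal_of B K \<Longrightarrow> J \<subseteq> K \<Longrightarrow> K \<noteq> B \<Longrightarrow> K = J"
      using max unfolding maximal_modular_left_ideal_of_def modular_left_ideal_of_def left_ideal_of_def
      by blast+
    have u_J: "u \<notin> J"
    proof
      assume "u \<in> J"
      then have "b \<in> J" if "b \<in> B" for b
        using J_left[OF that \<open>u \<in> J\<close>] by (simp add: right_identity)
      then show False using J_B J_ne by blast
    qed
    define I where "I = {b. u * b \<in> J}"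
    have I_sub: "complex_vector.subspace I"
      unfolding complex_vector.subspace_def I_def
      using J_sub by (auto simp: distrib_left mult_scaleC_right complex_vector.subspace_0
          intro: complex_vector.subspace_add complex_vector.subspace_scale)
    have J_I: "J \<subseteq> I" using J_B u_B by (auto simp: I_def subset_iff)
    have ideal2: "x * y \<in> I" if "y \<in> I" for x y
      using J_left[OF B_I[of x], of "u * y"] that by (simp add: I_def mult_u mult.assoc[symmetric])
        (simp add: mult.assoc mult_u)
    have I_comm: "x * y - y * x \<in> I" for x y
      using comm'[of x y] complex_vector.subspace_0[OF J_sub]
      by (simp add: I_def right_diff_distrib mult.assoc[symmetric])
    have ideal1: "x * y \<in> I" if "x \<in> I" for x y
      using complex_vector.subspace_add[OF I_sub I_comm[of x y] ideal2[OF that, of y]] by simp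
    have inv: "\<exists>b. b * x - u \<in> I" if x: "x \<notin> I" for x
    proof -
      \<comment> \<open>the left ideal of \<open>B\<close> generated by \<open>J\<close> and \<open>u * x\<close> contains \<open>u\<close> by maximality\<close>
      define K where "K = {j + b * (u * x) |j b. j \<in> J \<and> b \<in> B}"
      have "left_ideal_of B K"
        unfolding left_ideal_of_def
      proof (intro conjI ballI)
        have B_mult: "b * c \<in> B" if "b \<in> B" for b c
          using that by (auto simp: B_def mult.assoc)
        have B_add: "b + c \<in> B" if "b \<in> B" "c \<in> B" for b c
          using that by (auto simp: B_def distrib_left[symmetric])
        have B_scale: "r *\<^sub>C b \<in> B" if "b \<in> B" for b r
          using that by (auto simp: B_def mult_scaleC_right[symmetric])
        have B_0: "0 \<in> B" using B_I[of 0] by simp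
        show "K \<subseteq> B"
          using J_B by (auto simp: K_def intro!: B_add B_mult)
        show "complex_vector.subspace K"
          unfolding complex_vector.subspace_def
        proof (intro conjI ballI allI)
          show "0 \<in> K"
            unfolding K_def using complex_vector.subspace_0[OF J_sub] B_0 by force
          fix k assume "k \<in> K"
          then obtain j b where k: "k = j + b * (u * x)" "j \<in> J" "b \<in> B" by (auto simp: K_def)
          show "r *\<^sub>C k \<in> K" for r
          proof -
            have "r *\<^sub>C k = r *\<^sub>C j + (r *\<^sub>C b) * (u * x)"
              by (simp add: k scaleC_add_right mult_scaleC_left)
            then show ?thesis
              using k B_scale complex_vector.subspace_scale[OF J_sub] unfolding K_def by blast
          qed
          fix k' assume "k' \<in> K"
          then obtain j' b' where k': "k' = j' + b' * (u * x)" "j' \<in> J" "b' \<in> B" by (auto simp: K_def)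
          have "k + k' = (j + j') + (b + b') * (u * x)"
            by (simp add: k k' algebra_simps)
          then show "k + k' \<in> K"
            using k k' B_add complex_vector.subspace_add[OF J_sub] unfolding K_def by blast
        qed
        fix c k assume "c \<in> B" "k \<in> K"
        then obtain j b where k: "k = j + b * (u * x)" "j \<in> J" "b \<in> B" by (auto simp: K_def)
        have "c * k = c * j + (c * b) * (u * x)"
          by (simp add: k distrib_left mult.assoc)
        then show "c * k \<in> K"
          using k \<open>c \<in> B\<close> B_mult J_left unfolding K_def by blast
      qed
      moreover have "J \<subseteq> K"
      proof
        fix j assume "j \<in> J"
        moreover have "j = j + 0 * (u * x)" "0 \<in> B" using B_I[of 0] by simp_all
        ultimately show "j \<in> K" unfolding K_def by blast
      qed
      moreover have "u * x \<in> K"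
      proof -
        have "u * x = 0 + u * (u * x)" by (simp add: mult_u)
        then show ?thesis using uB complex_vector.subspace_0[OF J_sub] unfolding K_def by blast
      qed
      then have "K \<noteq> J" using x by (auto simp: I_def)
      ultimately have "K = B" using J_max by blast
      then have "u \<in> K" using uB by simp
      then obtain j b where "u = j + b * (u * x)" "j \<in> J" by (auto simp: K_def)
      then have "b * x - u = - j" by (simp add: mult_u)
      moreover have "- j \<in> I"
        using \<open>j \<in> J\<close> J_I complex_vector.subspace_neg[OF I_sub] by blast
      ultimately show ?thesis by metis
    qed
    have u_I: "u \<notin> I" using u_J by (simp add: I_def right_identity)
    have q_u: "infdist u I > 0"
    proof (rule ccontr)
      assume "\<not> ?thesis"
      then have "infdist u I = 0" using infdist_nonneg[of u I] by simp
      then obtain j where j: "j \<in> I" "norm (u - j) < 1"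
        using approx_infdist_subspace[OF I_sub, of 1 u] by auto
      obtain s where s: "s = u + (u - j) * s" using neumann_solution[OF j(2)] .
      have "u * s - s \<in> I"
        using complex_vector.subspace_0[OF J_sub] by (simp add: I_def right_diff_distrib mult_u)
      moreover have "u = j * s - (u * s - s)" using s by (simp add: algebra_simps)
      ultimately have "u \<in> I"
        using complex_vector.subspace_diff[OF I_sub ideal1[OF j(1)]] by metis
      then show False using u_I by simp
    qed
    have "\<exists>c. x - c *\<^sub>C u \<in> I" for x
      by (rule gelfand_mazur_modulo_ideal[where q = "\<lambda>a. infdist a I"])
        (use I_sub ideal1 ideal2 I_comm right_identity inv q_u in
          \<open>simp_all add: infdist_subspace_add infdist_subspace_scaleC infdist_ideal_mult\<close>)
    then obtain \<phi> where \<phi>: "\<And>x. x - \<phi> x *\<^sub>C u \<in> I" by metis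
    have uniq: "\<phi> x = c" if "x - c *\<^sub>C u \<in> I" for x c
    proof (rule ccontr)
      assume ne: "\<phi> x \<noteq> c"
      have "(x - c *\<^sub>C u) - (x - \<phi> x *\<^sub>C u) \<in> I"
        by (rule complex_vector.subspace_diff[OF I_sub that \<phi>])
      then have "(\<phi> x - c) *\<^sub>C u \<in> I" by (simp add: complex_vector.scale_left_diff_distrib)
      then have "inverse (\<phi> x - c) *\<^sub>C ((\<phi> x - c) *\<^sub>C u) \<in> I"
        by (rule complex_vector.subspace_scale[OF I_sub])
      then show False using ne u_I by (simp add: scaleC_scaleC scaleC_one)
    qed
    have "character \<phi>"
      unfolding character_def
    proof (intro conjI allI)
      show "\<phi> (x + y) = \<phi> x + \<phi> y" for x y
        using complex_vector.subspace_add[OF I_sub \<phi>[of x] \<phi>[of y]]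
        by (intro uniq) (simp add: algebra_simps scaleC_add_left)
      show "\<phi> (c *\<^sub>C x) = c * \<phi> x" for c x
        using complex_vector.subspace_scale[OF I_sub \<phi>[of x], of c]
        by (intro uniq) (simp add: complex_vector.scale_right_diff_distrib scaleC_scaleC)
      show "\<phi> (x * y) = \<phi> x * \<phi> y" for x y
      proof (rule uniq)
        have 1: "x * (y - \<phi> y *\<^sub>C u) \<in> I" by (rule ideal2[OF \<phi>])
        have 2: "\<phi> y *\<^sub>C (x - \<phi> x *\<^sub>C u) \<in> I" by (rule complex_vector.subspace_scale[OF I_sub \<phi>])
        show "x * y - (\<phi> x * \<phi> y) *\<^sub>C u \<in> I"
          using complex_vector.subspace_add[OF I_sub 1 2]
          by (simp add: right_diff_distrib mult_scaleC_right right_identity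
              complex_vector.scale_right_diff_distrib scaleC_scaleC mult.commute)
      qed
      have "\<phi> u = 1" using complex_vector.subspace_0[OF I_sub] by (intro uniq) (simp add: scaleC_one)
      then show "\<exists>x. \<phi> x \<noteq> 0" by (intro exI[of _ u]) simp
    qed
    then have "\<phi> a = 0" by (rule null)
    then show ?thesis using \<phi>[of a] by (simp add: I_def)
  qed
  then have "u * a \<in> jacobson_radical B" using B_I by (auto simp: jacobson_radical_def)
  then show ?thesis using semisimple by (simp add: semisimple_def B_def)
qed

section \<open>Derivations without continuity\<close>

text \<open>
  The elements on which two given distinct characters agree form a proper closed subspace, which has
  empty interior; countably many of these do not cover the algebra.
\<close>

lemma separating_element:
  fixes \<phi> :: "nat \<Rightarrow> 'a::complex_banach_algebra \<Rightarrow> complex"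
  assumes char: "\<And>i. character (\<phi> i)" and "inj \<phi>"
  obtains b where "inj (\<lambda>i. \<phi> i b)"
proof -
  define S where "S n = (case prod_decode n of (i, j) \<Rightarrow> if i = j then {} else {b. \<phi> i b = \<phi> j b})" for n
  have cont: "continuous_on UNIV (\<phi> i)" for i
    by (rule linear_continuous_on[OF character_bounded_linear[OF char]])
  have closed: "closed (S n)" for n
    unfolding S_def by (auto split: prod.split intro: closed_Collect_eq cont)
  have empty: "interior (S n) = {}" for n
  proof (rule ccontr)
    assume "interior (S n) \<noteq> {}"
    then obtain x r where r: "r > 0" "ball x r \<subseteq> S n"
      by (metis all_not_in_conv mem_interior)
    obtain i j where n: "prod_decode n = (i, j)" by fastforce
    have "x \<in> S n" using r by auto
    then have ij: "i \<noteq> j" and x: "\<phi> i x = \<phi> j x" by (auto simp: S_def n split: if_splits)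
    have "\<phi> i z = \<phi> j z" for z
    proof -
      define s where "s = r / (2 * (norm z + 1))"
      have nz: "norm z + 1 > 0" by (simp add: add_nonneg_pos)
      then have s: "s > 0" using r by (simp add: s_def)
      have "s * norm z < s * (2 * (norm z + 1))"
        by (rule mult_strict_left_mono[OF _ s]) (use nz in \<open>simp add: algebra_simps\<close>)
      also have "\<dots> = r" using nz by (simp add: s_def)
      finally have "x + s *\<^sub>R z \<in> ball x r" using s by (simp add: dist_norm)
      then have "\<phi> i (x + s *\<^sub>R z) = \<phi> j (x + s *\<^sub>R z)" using r by (auto simp: S_def n split: if_splits)
      then show ?thesis
        using s x by (simp add: character_add[OF char] character_scaleR[OF char])
    qed
    then show False using \<open>inj \<phi>\<close> ij by (metis ext injD)
  qed
  have "(\<Union>n. S n) \<noteq> UNIV"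
  proof
    assume "(\<Union>n. S n) = UNIV"
    then obtain n where "interior (S n) \<noteq> {}" by (rule closed_cover_imp_interior[OF closed])
    then show False using empty by simp
  qed
  then obtain b where b: "b \<notin> S n" for n by auto
  have "i = j" if "\<phi> i b = \<phi> j b" for i j
    using b[of "prod_encode (i, j)"] that by (simp add: S_def split: if_splits)
  then have "inj (\<lambda>i. \<phi> i b)" by (intro injI)
  then show ?thesis by (rule that)
qed

lemma character_finite_separation:
  fixes u :: "'a::complex_banach_algebra" and \<phi> :: "'a \<Rightarrow> complex"
  assumes right_identity: "\<And>a. a * u = a"
    and "finite S" "\<And>\<psi>. \<psi> \<in> S \<Longrightarrow> character \<psi>" "character \<phi>" "\<phi> \<notin> S"
  shows "\<exists>y. \<phi> y = 1 \<and> (\<forall>\<psi>\<in>S. \<psi> y = 0)"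
  using assms(2,3,5)
proof (induction S)
  case empty
  show ?case using character_right_identity[OF \<open>character \<phi>\<close> right_identity] by auto
next
  case (insert \<psi> S)
  then obtain y where y: "\<phi> y = 1" "\<forall>\<psi>\<in>S. \<psi> y = 0" by auto
  have \<psi>: "character \<psi>" using insert by simp
  obtain b where b: "\<psi> b \<noteq> \<phi> b" using insert by (metis ext insertCI)
  define z where "z = b - \<psi> b *\<^sub>C u"
  have z: "\<psi> z = 0" "\<phi> z \<noteq> 0"
    using b character_right_identity[OF \<psi> right_identity]
      character_right_identity[OF \<open>character \<phi>\<close> right_identity]
    by (auto simp: z_def character_diff \<psi> \<open>character \<phi>\<close> character_scaleC)
  show ?case
    using y z insert.prems(1) \<open>character \<phi>\<close>
    by (intro exI[of _ "inverse (\<phi> z) *\<^sub>C (y * z)"]) (auto simp: character_scaleC character_mult)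
qed

text \<open>
  A derivation, not assumed continuous, of a Banach algebra \<open>A\<close> with a right identity \<open>u\<close>.  The kernel of
  \<open>a \<mapsto> u * a\<close> is the right annihilator \<open>{n. A n = 0}\<close>; derivations preserve it (\<open>d_annihilator\<close>
  below), so that \<open>a \<mapsto> u * d a\<close> represents the derivation induced on the quotient by it.
\<close>

locale right_unital_derivation =
  fixes u :: "'a::complex_banach_algebra" and d :: "'a \<Rightarrow> 'a"
  assumes right_identity: "a * u = a"
    and d_add: "d (a + b) = d a + d b"
    and d_scaleC: "d (c *\<^sub>C a) = c *\<^sub>C d a"
    and d_mult: "d (a * b) = d a * b + a * d b"
begin

lemma d_zero: "d 0 = 0" using d_add[of 0 0] by simp

lemma d_diff: "d (a - b) = d a - d b" using d_add[of "a - b" b] by simp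

lemma d_scaleR: "d (r *\<^sub>R a) = r *\<^sub>R d a" by (simp add: scaleR_scaleC d_scaleC)

lemma mult_u: "x * (u * b) = x * b" by (metis mult.assoc right_identity)

lemma mult_d_unit: "a * d u = 0"
  using d_mult[of a u] by (simp add: right_identity)

lemma d_annihilator:
  assumes "u * n = 0" shows "u * d n = 0"
proof -
  have "0 = u * d (u * n)" using assms by (simp add: d_zero)
  also have "\<dots> = u * (d u * n) + u * (u * d n)" by (simp add: d_mult distrib_left)
  also have "u * (d u * n) = 0" by (metis mult.assoc mult_d_unit mult_zero_left)
  finally show ?thesis by (simp add: mult_u)
qed

definition discontinuity_characters :: "('a \<Rightarrow> complex) set" where
  "discontinuity_characters = {\<phi>. character \<phi> \<and> \<not> bounded_linear (\<lambda>a. \<phi> (d a))}"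

text \<open>
  By the product rule \<open>\<phi> (d (c * x))\<close> is \<open>\<phi> c * \<phi> (d x)\<close> plus a term bounded in \<open>x\<close>, so it is
  unbounded on every ball when \<open>\<phi> c \<noteq> 0\<close>.
\<close>

lemma large_value_at_discontinuity:
  assumes \<phi>: "\<phi> \<in> discontinuity_characters" and c: "\<phi> c \<noteq> 0" and e: "e > 0"
  shows "\<exists>x. norm x \<le> e \<and> R \<le> norm (\<phi> (d (c * x)))"
proof (rule ccontr)
  assume "\<not> ?thesis"
  then have bd: "norm (\<phi> (d (c * x))) < R" if "norm x \<le> e" for x using that by force
  have char: "character \<phi>" and unbounded: "\<not> bounded_linear (\<lambda>a. \<phi> (d a))"
    using \<phi> by (auto simp: discontinuity_characters_def)
  note chs = character_add[OF char] character_scaleR[OF char] character_mult[OF char] character_zero[OF char]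
  have bl: "bounded_linear (\<lambda>x. \<phi> (d (c * x)))"
  proof (rule bounded_linear_intro[of _ "R / e"])
    fix x
    show "norm (\<phi> (d (c * x))) \<le> norm x * (R / e)"
    proof (cases "x = 0")
      case True
      then show ?thesis by (simp add: d_zero chs)
    next
      case False
      define s where "s = e / norm x"
      have s: "s > 0" using False e by (simp add: s_def)
      have "norm (\<phi> (d (c * (s *\<^sub>R x)))) < R"
        using False e by (intro bd) (simp add: s_def)
      then have "s * norm (\<phi> (d (c * x))) < R"
        using s by (simp add: d_scaleR chs)
      then show ?thesis using e False by (simp add: s_def field_simps)
    qed
  qed (simp_all add: distrib_left d_add d_scaleR chs)
  have "bounded_linear (\<lambda>x. inverse (\<phi> c) * (\<phi> (d (c * x)) - \<phi> (d c) * \<phi> x))"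
    by (intro bounded_linear_const_mult bounded_linear_sub bl character_bounded_linear[OF char])
  also have "(\<lambda>x. inverse (\<phi> c) * (\<phi> (d (c * x)) - \<phi> (d c) * \<phi> x)) = (\<lambda>x. \<phi> (d x))"
    using c by (intro ext) (simp add: d_mult chs field_simps)
  finally show False using unbounded by simp
qed

text \<open>
  Recursive at the left end, so that the factor \<open>g m\<close> splits off from a whole series of such terms.
\<close>

fun nested_product :: "(nat \<Rightarrow> 'a) \<Rightarrow> nat \<Rightarrow> nat \<Rightarrow> 'a \<Rightarrow> 'a" where
  "nested_product g m 0 x = x"
| "nested_product g m (Suc k) x = g m * nested_product g (Suc m) k x"

lemma norm_nested_product:
  assumes "\<And>n. norm (g n) \<le> 1"
  shows "norm (nested_product g m k x) \<le> norm x"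
proof (induction k arbitrary: m)
  case (Suc k)
  have "norm (nested_product g m (Suc k) x) \<le> norm (g m) * norm (nested_product g (Suc m) k x)"
    by (simp add: norm_mult_ineq)
  also have "\<dots> \<le> 1 * norm x" using assms Suc by (intro mult_mono) auto
  finally show ?case by simp
qed simp

text \<open>
  A gliding hump.  Suppose that there are distinct characters \<open>\<phi> 0, \<phi> 1, \<dots>\<close> at which \<open>d\<close> is
  discontinuous.  Choose elements \<open>e j\<close> with \<open>\<phi> i (e j) = 0\<close> exactly for \<open>i = j\<close>, put \<open>g j = e j * e j\<close>
  and \<open>c m = u * g 0 * \<dots> * g (m - 1)\<close>, and consider \<open>z = (\<Sum>m. c m * x m)\<close> with small
  \<open>x m\<close>.  All terms after the \<open>m\<close>-th have the square \<open>g m\<close> as a common factor, so the product rule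
  makes \<open>\<phi> m (d \<dots>)\<close> vanish on the whole tail, although \<open>d\<close> need not commute with the infinite sum.
  Hence \<open>\<phi> m (d z)\<close> is determined by \<open>x 0, \<dots>, x m\<close>, and the choice of \<open>x m\<close> can make it larger
  than \<open>m\<close>.  But characters are contractive, so \<open>m \<le> norm (d z)\<close> for all \<open>m\<close>.
\<close>

theorem finite_discontinuity_characters: "finite discontinuity_characters"
proof (rule ccontr)
  assume "infinite discontinuity_characters"
  then obtain \<phi> :: "nat \<Rightarrow> 'a \<Rightarrow> complex" where inj: "inj \<phi>" and "range \<phi> \<subseteq> discontinuity_characters"
    using infinite_countable_subset by blast
  then have disc: "\<phi> i \<in> discontinuity_characters" for i by auto
  then have char: "character (\<phi> i)" for i by (simp add: discontinuity_characters_def)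
  note chs = character_add[OF char] character_scaleC[OF char] character_scaleR[OF char]
    character_mult[OF char] character_zero[OF char] character_diff[OF char]
  have unit: "\<phi> i u = 1" for i by (rule character_right_identity[OF char right_identity])
  obtain b where b: "inj (\<lambda>i. \<phi> i b)" using separating_element[OF char inj] .
  define e0 where "e0 j = b - \<phi> j b *\<^sub>C u" for j
  \<comment> \<open>scaled to norm at most 1, so that summability of \<open>norm (x m)\<close> is enough for all tails\<close>
  define e where "e j = (1 / (1 + norm (e0 j))) *\<^sub>R e0 j" for j
  have e0_pos: "1 + norm (e0 j) > 0" for j by (simp add: add_pos_nonneg)
  have e_eq: "\<phi> i (e j) = 0 \<longleftrightarrow> i = j" for i j
    using e0_pos[of j] b by (auto simp: e_def e0_def chs unit inj_def)
  define g where "g j = e j * e j" for j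
  have "norm (e j) \<le> 1" for j using e0_pos[of j] by (simp add: e_def)
  then have g_norm: "norm (g j) \<le> 1" for j
    unfolding g_def by (meson mult_le_one norm_ge_zero norm_mult_ineq order_trans)
  define c where "c = rec_nat u (\<lambda>m y. y * g m)"
  have c_0: "c 0 = u" and c_Suc: "c (Suc m) = c m * g m" for m by (simp_all add: c_def)
  have c_nz: "\<phi> i (c m) \<noteq> 0" if "i \<ge> m" for i m
    using that by (induction m) (auto simp: c_0 c_Suc unit chs g_def e_eq)
  \<comment> \<open>\<open>s m\<close> is the partial sum over the \<open>x i\<close> with \<open>i < m\<close>, on which the choice of \<open>x m\<close> depends\<close>
  have "\<exists>s. \<forall>m. (m = 0 \<longrightarrow> s m = 0) \<and> (\<exists>x. norm x \<le> (1/2)^m \<and> s (Suc m) = s m + c m * x \<and>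
      real m + norm (\<phi> m (d (s m))) \<le> norm (\<phi> m (d (c m * x))))"
  proof (rule dependent_nat_choice)
    fix t :: 'a and m :: nat assume "m = 0 \<longrightarrow> t = 0"
    obtain x where "norm x \<le> (1/2)^m" "real m + norm (\<phi> m (d t)) \<le> norm (\<phi> m (d (c m * x)))"
      using large_value_at_discontinuity[OF disc[of m], of "c m" "(1/2)^m"] c_nz[of m m] by auto
    then show "\<exists>y. (Suc m = 0 \<longrightarrow> y = 0) \<and> (\<exists>x. norm x \<le> (1/2)^m \<and> y = t + c m * x \<and>
      real m + norm (\<phi> m (d t)) \<le> norm (\<phi> m (d (c m * x))))" by auto
  qed auto
  then obtain s where s: "\<forall>m. (m = 0 \<longrightarrow> s m = 0) \<and> (\<exists>x. norm x \<le> (1/2)^m \<and>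
      s (Suc m) = s m + c m * x \<and> real m + norm (\<phi> m (d (s m))) \<le> norm (\<phi> m (d (c m * x))))"
    by (rule exE)
  have s_0: "s 0 = 0" using s by simp
  have "\<forall>m. \<exists>x. norm x \<le> (1/2)^m \<and> s (Suc m) = s m + c m * x \<and>
      real m + norm (\<phi> m (d (s m))) \<le> norm (\<phi> m (d (c m * x)))"
    using s by simp
  then have "\<exists>x. \<forall>m. norm (x m) \<le> (1/2)^m \<and> s (Suc m) = s m + c m * x m \<and>
      real m + norm (\<phi> m (d (s m))) \<le> norm (\<phi> m (d (c m * x m)))"
    by (rule choice)
  then obtain x where "\<forall>m. norm (x m) \<le> (1/2)^m \<and> s (Suc m) = s m + c m * x m \<and>
      real m + norm (\<phi> m (d (s m))) \<le> norm (\<phi> m (d (c m * x m)))"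
    by (rule exE)
  then have x: "norm (x m) \<le> (1/2)^m" and s_Suc: "s (Suc m) = s m + c m * x m"
    and large: "real m + norm (\<phi> m (d (s m))) \<le> norm (\<phi> m (d (c m * x m)))" for m
    by blast+
  define y where "y m = (\<Sum>k. nested_product g m k (x (m + k)))" for m
  have smm: "summable (\<lambda>k. nested_product g m k (x (m + k)))" for m
  proof (rule summable_comparison_test'[of "\<lambda>k. (1/2::real)^k" 0])
    fix k
    have "norm (nested_product g m k (x (m + k))) \<le> (1/2)^(m + k)"
      by (rule order_trans[OF norm_nested_product[OF g_norm] x])
    also have "\<dots> \<le> (1/2)^k" by (intro power_decreasing) auto
    finally show "norm (nested_product g m k (x (m + k))) \<le> (1/2)^k" .
  qed (simp add: summable_geometric)
  have y_rec: "y m = x m + g m * y (Suc m)" for m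
    using suminf_split_head[OF smm[of m]] suminf_mult[OF smm[of "Suc m"], of "g m"]
    by (simp add: y_def diff_eq_eq add.commute)
  \<comment> \<open>\<open>u * y 0\<close> is the element \<open>z\<close> above, and \<open>c m * y m\<close> its tail from the \<open>m\<close>-th term on\<close>
  have target: "u * y 0 = s m + c m * y m" for m
  proof (induction m)
    case (Suc m)
    have "c m * y m = c m * x m + c (Suc m) * y (Suc m)"
      using arg_cong[OF y_rec[of m], of "(*) (c m)"] by (simp add: distrib_left c_Suc mult.assoc)
    then show ?case unfolding Suc.IH s_Suc by (simp add: add.assoc)
  qed (simp add: s_0 c_0)
  have e_0: "\<phi> m (e m) = 0" for m by (simp only: e_eq)
  have tail: "\<phi> m (d (c (Suc m) * y (Suc m))) = 0" for m
    unfolding c_Suc g_def d_mult chs by (simp add: e_0)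
  have "real m \<le> norm (d (u * y 0))" for m
  proof -
    have eq: "u * y 0 = s m + c m * x m + c (Suc m) * y (Suc m)"
      unfolding target[of "Suc m"] s_Suc ..
    have "\<phi> m (d (u * y 0)) = \<phi> m (d (s m)) + \<phi> m (d (c m * x m))"
      unfolding eq d_add chs(1) tail by (rule add_0_right)
    then have "norm (\<phi> m (d (c m * x m))) \<le> norm (\<phi> m (d (u * y 0))) + norm (\<phi> m (d (s m)))"
      by (metis add_diff_cancel_left' norm_triangle_ineq4)
    then have "real m \<le> norm (\<phi> m (d (u * y 0)))"
      using large[of m] by linarith
    then show ?thesis by (rule order_trans[OF _ character_norm_le[OF char]])
  qed
  then show False using reals_Archimedean2[of "norm (d (u * y 0))"] by (auto simp: not_le[symmetric])
qed

text \<open>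
  The Singer--Wermer theorem when the induced derivation \<open>T\<close> is bounded.  By the Leibniz rule the
  Taylor series \<open>F a\<close> of \<open>t \<mapsto> \<phi> (exp (t T) a)\<close> depends multiplicatively on \<open>a\<close>.
  If \<open>\<phi> a = 0\<close>, then \<open>F a\<close> starts with \<open>\<phi> (d a)\<close> in degree one, so comparing the coefficients of degree \<open>n\<close>
  of the \<open>n\<close>-th power gives \<open>\<phi> ((T ^^ n) (a ^ n)) = fact n * \<phi> (d a) ^ n\<close>.  The left side grows at most
  geometrically in \<open>n\<close>, so \<open>\<phi> (d a) = 0\<close>.
\<close>

lemma singer_wermer:
  assumes bounded: "bounded_linear (\<lambda>a. u * d a)" and char: "character \<phi>"
  shows "\<phi> (d a) = 0"
proof -
  note chs = character_add[OF char] character_scaleC[OF char]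
    character_mult[OF char] character_zero[OF char] character_diff[OF char]
  have unit: "\<phi> u = 1" by (rule character_right_identity[OF char right_identity])
  define T where "T a = u * d a" for a
  have T_add: "T (a + b) = T a + T b" for a b by (simp add: T_def d_add distrib_left)
  have Tn_add: "(T ^^ m) (a + b) = (T ^^ m) a + (T ^^ m) b" for m a b
    by (induction m) (simp_all add: T_add)
  have T_mult: "T (a * b) = T a * b + u * a * T b" for a b
    by (simp add: T_def d_mult distrib_left mult.assoc mult_u)
  have T_u: "T u = 0" by (simp add: T_def mult_d_unit)
  have T_u_mult: "T (u * a) = T a" for a
    by (simp add: T_mult T_u right_identity) (simp add: T_def mult_u)
  define F where "F a = Abs_fps (\<lambda>m. \<phi> ((T ^^ m) a) / fact m)" for a
  have F_nth: "fps_nth (F a) m = \<phi> ((T ^^ m) a) / fact m" for a m by (simp add: F_def)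
  have F_Suc: "fps_nth (F a) (Suc m) = fps_nth (F (T a)) m / of_nat (Suc m)" for a m
    unfolding F_nth funpow_Suc_right comp_apply by (simp add: field_simps)
  have deriv: "fps_deriv (F a) = F (T a)" for a
    by (rule fps_ext) (simp add: F_Suc del: of_nat_Suc)
  have F_add: "F (a + b) = F a + F b" for a b
    by (rule fps_ext) (simp add: F_nth Tn_add chs add_divide_distrib)
  have F_u_mult: "F (u * a) = F a" for a
  proof (rule fps_ext)
    fix m show "fps_nth (F (u * a)) m = fps_nth (F a) m"
      by (cases m) (simp_all only: F_Suc T_u_mult, simp add: F_nth chs unit)
  qed
  have F_mult_nth: "fps_nth (F (a * b)) m = fps_nth (F a * F b) m" for a b m
  proof (induction m arbitrary: a b)
    case 0
    show ?case by (simp add: F_nth chs)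
  next
    case (Suc m)
    have "fps_nth (F (a * b)) (Suc m) = (fps_nth (F (T a * b)) m + fps_nth (F (u * a * T b)) m) / of_nat (Suc m)"
      by (simp only: F_Suc T_mult F_add fps_add_nth)
    also have "\<dots> = fps_nth (F (T a) * F b + F a * F (T b)) m / of_nat (Suc m)"
      by (simp only: Suc F_u_mult fps_add_nth)
    also have "\<dots> = fps_nth (fps_deriv (F a * F b)) m / of_nat (Suc m)"
      by (simp add: deriv add.commute)
    also have "\<dots> = fps_nth (F a * F b) (Suc m)"
      by (simp only: fps_deriv_nth Suc_eq_plus1[symmetric]) (simp del: of_nat_Suc)
    finally show ?case .
  qed
  have F_mult: "F (a * b) = F a * F b" for a b by (rule fps_ext) (rule F_mult_nth)
  have F_u: "F u = 1"
  proof (rule fps_ext)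
    fix m
    have "F 0 = 0" using F_add[of 0 0] by simp
    then show "fps_nth (F u) m = fps_nth (1::complex fps) m"
      by (cases m) (simp_all add: F_nth[of _ 0] F_Suc T_u unit)
  qed
  obtain K where K: "K \<ge> 0" "\<And>a. norm (T a) \<le> norm a * K"
    using bounded_linear.nonneg_bounded[OF bounded] by (auto simp: T_def)
  have Tn_norm: "norm ((T ^^ n) a) \<le> K ^ n * norm a" for n a
  proof (induction n)
    case (Suc n)
    have "norm ((T ^^ Suc n) a) \<le> norm ((T ^^ n) a) * K" using K by simp
    also have "\<dots> \<le> (K ^ n * norm a) * K" using Suc K by (intro mult_right_mono)
    finally show ?case by (simp add: mult_ac)
  qed simp
  have null: "\<phi> (d a) = 0" if a: "\<phi> a = 0" for a
  proof (rule ccontr)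
    define t where "t = \<phi> (d a)"
    assume "\<phi> (d a) \<noteq> 0"
    then have t: "norm t > 0" by (simp add: t_def)
    \<comment> \<open>the powers of \<open>a\<close>, with \<open>u\<close> as the zeroth one, which is harmless as \<open>F u = 1\<close>\<close>
    define p where "p n = (((*) a) ^^ n) u" for n
    have Fp: "F (p n) = F a ^ n" for n
      by (induction n) (simp_all add: p_def F_mult F_u)
    have p_norm: "norm (p n) \<le> norm a ^ n * norm u" for n
    proof (induction n)
      case (Suc n)
      have "norm (p (Suc n)) \<le> norm a * norm (p n)" by (simp add: p_def norm_mult_ineq)
      also have "\<dots> \<le> norm a * (norm a ^ n * norm u)" using Suc by (intro mult_left_mono) auto
      finally show ?case by simp
    qed (simp add: p_def)
    have "fps_nth (F a) 0 = 0" "fps_nth (F a) 1 = t" using a by (simp_all add: F_nth t_def T_def chs unit)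
    then have "fps_nth (F (p n)) n = t ^ n" for n
      unfolding Fp by (metis startsby_zero_power_nth_same)
    then have tn: "\<phi> ((T ^^ n) (p n)) = t ^ n * fact n" for n by (simp add: F_nth field_simps)
    have est: "1 \<le> norm u * (inverse (fact n) * (K * norm a / norm t) ^ n)" for n
    proof -
      have "norm t ^ n * fact n = norm (\<phi> ((T ^^ n) (p n)))"
        by (simp add: tn norm_mult norm_power)
      also have "\<dots> \<le> norm ((T ^^ n) (p n))" by (rule character_norm_le[OF char])
      also have "\<dots> \<le> K ^ n * norm (p n)" by (rule Tn_norm)
      also have "\<dots> \<le> K ^ n * (norm a ^ n * norm u)" using K p_norm by (intro mult_left_mono) auto
      finally show ?thesis using t by (simp add: field_simps power_mult_distrib power_divide)
    qed
    have "(\<lambda>n. norm u * (inverse (fact n) * (K * norm a / norm t) ^ n)) \<longlonglongrightarrow> norm u * 0"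
      by (intro tendsto_mult tendsto_const summable_LIMSEQ_zero summable_exp)
    then have "1 \<le> norm u * 0" using est by (intro LIMSEQ_le_const) auto
    then show False by simp
  qed
  have "\<phi> (d (a - \<phi> a *\<^sub>C u)) = 0" by (intro null) (simp add: chs unit)
  moreover have "\<phi> (u * d u) = 0" by (simp only: mult_d_unit chs)
  then have "\<phi> (d u) = 0" by (simp add: chs unit)
  ultimately show ?thesis by (simp add: d_diff d_scaleC chs)
qed

text \<open>
  Johnson's theorem.  Let \<open>\<phi>\<close> be a character at which \<open>d\<close> is discontinuous, and suppose that some
  element killed by all characters at which \<open>d\<close> is continuous is not killed by \<open>\<phi>\<close>.  As there are only
  finitely many others, it can be multiplied to an element \<open>x\<close> that all characters but \<open>\<phi>\<close> kill.
  Characters separate, so \<open>x * z\<close> and \<open>\<phi> z *\<^sub>C x\<close> agree modulo the annihilator for every \<open>z\<close>; applying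
  \<open>\<phi> \<circ> d\<close> gives \<open>\<phi> (d z) = 0\<close>, a contradiction to discontinuity.

  Therefore the characters at which \<open>d\<close> is continuous already separate.  The closed graph theorem
  makes \<open>a \<mapsto> u * d a\<close> bounded, and \<open>singer_wermer\<close> applies.
\<close>

theorem johnson_derivation_vanishes:
  assumes separate: "\<And>a. (\<And>\<phi>. character \<phi> \<Longrightarrow> \<phi> a = 0) \<Longrightarrow> u * a = 0"
  shows "u * d a = 0"
proof -
  have null: "\<phi> a = 0" if a: "\<And>\<psi>. character \<psi> \<Longrightarrow> \<psi> \<notin> discontinuity_characters \<Longrightarrow> \<psi> a = 0"
    and char: "character \<phi>" for \<phi> a
  proof (rule ccontr)
    assume nz: "\<phi> a \<noteq> 0"
    then have disc: "\<phi> \<in> discontinuity_characters" using a char by blast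
    note chs = character_add[OF char] character_scaleC[OF char]
      character_mult[OF char] character_zero[OF char] character_diff[OF char]
    have "\<exists>y. \<phi> y = 1 \<and> (\<forall>\<psi>\<in>discontinuity_characters - {\<phi>}. \<psi> y = 0)"
      using char finite_discontinuity_characters right_identity
      by (intro character_finite_separation) (auto simp: discontinuity_characters_def)
    then obtain y where y: "\<phi> y = 1" "\<And>\<psi>. \<psi> \<in> discontinuity_characters \<Longrightarrow> \<psi> \<noteq> \<phi> \<Longrightarrow> \<psi> y = 0" by blast
    define x where "x = inverse (\<phi> a) *\<^sub>C (a * y)"
    have x: "\<phi> x = 1" using nz y by (simp add: x_def chs)
    have x0: "\<psi> x = 0" if "character \<psi>" "\<psi> \<noteq> \<phi>" for \<psi>
      using a[OF that(1)] y(2)[OF _ that(2)] that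
      by (cases "\<psi> \<in> discontinuity_characters") (auto simp: x_def character_scaleC character_mult)
    have "\<phi> (d z) = 0" for z
    proof -
      have "u * (x * z - \<phi> z *\<^sub>C x) = 0"
      proof (rule separate)
        fix \<psi> :: "'a \<Rightarrow> complex" assume "character \<psi>"
        then show "\<psi> (x * z - \<phi> z *\<^sub>C x) = 0"
          using x0[of \<psi>] by (cases "\<psi> = \<phi>") (simp_all add: character_diff character_mult character_scaleC)
      qed
      then have "u * d (x * z - \<phi> z *\<^sub>C x) = 0" by (rule d_annihilator)
      then have "\<phi> (u * d (x * z - \<phi> z *\<^sub>C x)) = 0" by (simp add: chs)
      then show ?thesis
        by (simp add: chs d_diff d_mult d_scaleC x character_right_identity[OF char right_identity])
    qed
    then have "(\<lambda>z. \<phi> (d z)) = (\<lambda>z. 0)" by simp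
    then show False using disc bounded_linear_zero by (simp add: discontinuity_characters_def)
  qed
  have bounded: "bounded_linear (\<lambda>a. u * d a)"
  proof (rule closed_graph_imp_bounded_linear)
    show "linear (\<lambda>a. u * d a)"
      by (rule linearI) (simp_all add: d_add d_scaleR distrib_left)
    fix X y assume X: "X \<longlonglongrightarrow> 0" and lim: "(\<lambda>n. u * d (X n)) \<longlonglongrightarrow> y"
    have "(\<lambda>n. u * (u * d (X n))) \<longlonglongrightarrow> u * y" by (intro tendsto_intros lim)
    then have uy: "u * y = y" using lim LIMSEQ_unique by (auto simp: mult_u)
    have "\<psi> y = 0" if char: "character \<psi>" and "\<psi> \<notin> discontinuity_characters" for \<psi>
    proof -
      have "bounded_linear (\<lambda>a. \<psi> (d a))" using that by (simp add: discontinuity_characters_def)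
      then have "(\<lambda>n. \<psi> (d (X n))) \<longlonglongrightarrow> \<psi> (d 0)" using X by (rule bounded_linear.tendsto)
      moreover have "(\<lambda>n. \<psi> (u * d (X n))) \<longlonglongrightarrow> \<psi> y"
        by (rule bounded_linear.tendsto[OF character_bounded_linear[OF char] lim])
      ultimately show ?thesis
        using LIMSEQ_unique
        by (auto simp: character_mult[OF char] character_right_identity[OF char right_identity]
            d_zero character_zero[OF char])
    qed
    then have "\<phi> y = 0" if "character \<phi>" for \<phi> using null[OF _ that] by blast
    then have "u * y = 0" by (rule separate)
    then show "y = 0" using uy by simp
  qed
  show ?thesis
    by (rule separate) (rule singer_wermer[OF bounded])
qed

end

section \<open>Symmetric biderivations\<close>

lemma mult_pos_power_eq_0:
  fixes b :: "'a::complex_banach_algebra"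
  assumes "\<And>x. x * b = 0 \<Longrightarrow> x = 0" and "x * pos_power b k = 0"
  shows "x = 0"
proof -
  have "x * ((*) b ^^ n) b = 0 \<Longrightarrow> x = 0" for n x
  proof (induction n arbitrary: x)
    case (Suc n)
    then have "(x * b) * ((*) b ^^ n) b = 0" by (simp add: mult.assoc)
    then show ?case using Suc.IH assms(1) by blast
  qed (use assms(1) in simp)
  then show ?thesis using assms(2) by (simp add: pos_power_def)
qed

theorem theorem2p3:
  fixes u :: "'a::complex_banach_algebra"
    and D :: "'a \<Rightarrow> 'a \<Rightarrow> 'a"
    and f :: "'a \<Rightarrow> 'a"
  assumes right_identity: "\<And>a. a * u = a"
    and comm: "commutative_on {u * a |a. True}"
    and semisimple: "semisimple {u * a |a. True}"
    and D: "symmetric_biderivation D"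
    and f: "f = bitrace D"
  shows "((\<exists>k\<ge>1. k_commuting k f) \<longleftrightarrow> (\<exists>k\<ge>1. k_centralizing k f)) \<and>
         ((\<exists>k\<ge>1. k_centralizing k f) \<longleftrightarrow> (\<exists>k\<ge>1. k_skew_commuting k f)) \<and>
         ((\<exists>k\<ge>1. k_skew_commuting k f) \<longleftrightarrow> (\<exists>k\<ge>1. k_skew_centralizing k f)) \<and>
         ((\<exists>k\<ge>1. k_skew_centralizing k f) \<longleftrightarrow> (\<forall>a b. D a b = 0))"
proof -
  have D_sym: "D a b = D b a" and D_scaleC: "D (c *\<^sub>C a) b = c *\<^sub>C D a b"
    and D_add: "D (a + b) e = D a e + D b e" and D_mult: "D (a * b) e = D a e * b + a * D b e"
    for a b c e
    using D by (auto simp: symmetric_biderivation_def symmetric_bilinear_def)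
  have uD: "u * D a b = 0" for a b
  proof -
    interpret right_unital_derivation u "\<lambda>x. D x b"
      by unfold_locales (simp_all add: right_identity D_add D_scaleC D_mult)
    show ?thesis
      by (rule johnson_derivation_vanishes) (rule semisimple_characters_separate[OF right_identity comm semisimple])
  qed
  then have left_f: "a * f b = 0" for a b
    by (metis bitrace_def f mult.assoc mult_zero_right right_identity)
  have zero: "D a b = 0" if prod: "\<And>a. f a * pos_power a k = 0" for k a b
  proof -
    \<comment> \<open>for large \<open>r\<close> right multiplication by \<open>a + r *\<^sub>R u\<close> is injective, so the power can be cancelled\<close>
    have shifted: "f (a + r *\<^sub>R u) = 0" if r: "r > norm a" for a r
    proof (rule mult_pos_power_eq_0[OF _ prod])
      fix x assume "x * (a + r *\<^sub>R u) = 0"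
      then have "r *\<^sub>R x = - (x * a)"
        by (simp add: distrib_left right_identity add_eq_0_iff)
      then have "norm (r *\<^sub>R x) = norm (x * a)" by simp
      then have "\<bar>r\<bar> * norm x \<le> norm a * norm x"
        using norm_mult_ineq[of x a] by (simp add: mult.commute)
      then show "x = 0" using r by (auto simp: mult_le_cancel_right)
    qed
    have f_0: "f a = 0" for a
    proof -
      have f_u: "f u = 0" using shifted[of 0 1] by simp
      have expand: "f (a + r *\<^sub>R u) = f a + r *\<^sub>R D a u + r *\<^sub>R D a u" for r
      proof -
        have scale: "D (s *\<^sub>R x) y = s *\<^sub>R D x y" for s x y
          by (simp add: scaleR_scaleC D_scaleC)
        have "D x (y + z) = D x y + D x z" "D x (s *\<^sub>R y) = s *\<^sub>R D x y" for x y z s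
          by (metis D_sym D_add) (metis D_sym scale)
        then show ?thesis
          using f_u scale D_sym[of u a] by (simp add: f bitrace_def D_add add.assoc)
      qed
      \<comment> \<open>comparing the shifts by \<open>r\<close> and by \<open>2 * r\<close> separates \<open>f a\<close> from the part linear in the shift\<close>
      define r where "r = norm a + 1"
      have r: "r > 0" by (simp add: r_def add_nonneg_pos)
      have 1: "f a + r *\<^sub>R D a u + r *\<^sub>R D a u = 0"
        using shifted[of a r] by (simp add: expand r_def)
      have 2: "f a + (2 * r) *\<^sub>R D a u + (2 * r) *\<^sub>R D a u = 0"
        using shifted[of a "2 * r"] r by (simp add: expand r_def)
      have "(2 * r) *\<^sub>R D a u = r *\<^sub>R D a u + r *\<^sub>R D a u"
        by (simp flip: scaleR_add_left)
      with 1 2 have "r *\<^sub>R D a u + r *\<^sub>R D a u = 0" by (simp add: add.assoc)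
      with 1 show ?thesis by (simp add: add.assoc)
    qed
    have "f (a + b) = f a + f b + D a b + D a b"
      using D_sym[of b a] D_sym[of b "a + b"] D_sym[of a "a + b"]
      by (simp add: f bitrace_def D_add scaleR_add_right)
    then have "D a b + D a b = 0" by (simp add: f_0)
    then have "2 *\<^sub>R D a b = 0" by (simp add: scaleR_2)
    then show ?thesis by simp
  qed
  have central: "f a * z = 0" if "f a * z \<in> center" for a z
  proof -
    have "f a * z = (f a * z) * u" by (simp add: right_identity)
    also have "\<dots> = u * (f a * z)" using that by (simp add: center_def)
    also have "\<dots> = 0" by (simp add: left_f flip: mult.assoc)
    finally show ?thesis .
  qed
  let ?E = "\<forall>a b. D a b = 0"
  have collapse: "?E" if "\<forall>a. f a * pos_power a k \<in> center" for k
    using zero[of k] central that by blast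
  have c0: "(0::'a) \<in> center" by (simp add: center_def)
  have 1: "(\<exists>k\<ge>1. k_commuting k f) \<longleftrightarrow> ?E"
  proof
    assume "\<exists>k\<ge>1. k_commuting k f"
    then obtain k where "k_commuting k f" by blast
    then show ?E by (intro collapse[of k]) (simp add: k_commuting_def left_f c0)
  next
    assume ?E
    then show "\<exists>k\<ge>1. k_commuting k f" by (auto simp: k_commuting_def f bitrace_def c0)
  qed
  have 2: "(\<exists>k\<ge>1. k_centralizing k f) \<longleftrightarrow> ?E"
  proof
    assume "\<exists>k\<ge>1. k_centralizing k f"
    then obtain k where "k_centralizing k f" by blast
    then show ?E by (intro collapse[of k]) (simp add: k_centralizing_def left_f c0)
  next
    assume ?E
    then show "\<exists>k\<ge>1. k_centralizing k f" by (auto simp: k_centralizing_def f bitrace_def c0)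
  qed
  have 3: "(\<exists>k\<ge>1. k_skew_commuting k f) \<longleftrightarrow> ?E"
  proof
    assume "\<exists>k\<ge>1. k_skew_commuting k f"
    then obtain k where "k_skew_commuting k f" by blast
    then show ?E by (intro collapse[of k]) (simp add: k_skew_commuting_def left_f c0)
  next
    assume ?E
    then show "\<exists>k\<ge>1. k_skew_commuting k f" by (auto simp: k_skew_commuting_def f bitrace_def c0)
  qed
  have 4: "(\<exists>k\<ge>1. k_skew_centralizing k f) \<longleftrightarrow> ?E"
  proof
    assume "\<exists>k\<ge>1. k_skew_centralizing k f"
    then obtain k where "k_skew_centralizing k f" by blast
    then show ?E by (intro collapse[of k]) (simp add: k_skew_centralizing_def left_f c0)
  next
    assume ?E
    then show "\<exists>k\<ge>1. k_skew_centralizing k f" by (auto simp: k_skew_centralizing_def f bitrace_def c0)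
  qed
  show ?thesis unfolding 1 2 3 4 by simp
qed

end
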